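(* Let $U$ be a $t$-dimensional (over $\mathbb{F}_q$) $(h,k)_q$-evasive subspace of $V=V(r,q^n)$ with $r<t$ and $k<t-r+h-1$, and let $\bar U$ be a Delsarte dual of $U$ in $\mathbb{V}/\Gamma^\perp\cong V(t-r,q^n)$ (constructed as in the context, for any admissible choice of $\mathbb{V},\Gamma,W,\beta',\beta$). Then every $(t-r+h-k-1)$-dimensional $\mathbb{F}_{q^n}$-subspace of $\mathbb{V}/\Gamma^\perp$ meets $\bar U$ in an $\mathbb{F}_q$-subspace of dimension at most $t-k-2$. In particular, if $\langle\bar U\rangle_{\mathbb{F}_{q^n}}$ has $\mathbb{F}_{q^n}$-dimension at least $t-r+h-k-1$, then $\bar U$ is a $(t-r+h-k-1,t-k-2)_q$-evasive subspace of $\mathbb{V}/\Gamma^\perp$ of $\mathbb{F}_q$-dimension at least $t-r+h+1$.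
   Context: $V(m,q^n)$ denotes an $m$-dimensional vector space over $\mathbb{F}_{q^n}$, viewed also as an $mn$-dimensional vector space over $\mathbb{F}_q$. For positive integers $h,k$, an $\mathbb{F}_q$-subspace $U$ of an $\mathbb{F}_{q^n}$-vector space $V$ is $(h,k)_q$-evasive if $\langle U\rangle_{\mathbb{F}_{q^n}}$ has $\mathbb{F}_{q^n}$-dimension at least $h$ and every $h$-dimensional $\mathbb{F}_{q^n}$-subspace of $V$ meets $U$ in an $\mathbb{F}_q$-subspace of $\mathbb{F}_q$-dimension at most $k$. Delsarte dual: let $U$ be a $t$-dimensional $\mathbb{F}_q$-subspace of $V=V(r,q^n)$ with $t>r$. Embed $V$ in $\mathbb{V}=V(t,q^n)$ with $\mathbb{V}=V\oplus\Gamma$ for a $(t-r)$-dimensional $\mathbb{F}_{q^n}$-subspace $\Gamma$, such that $U=\langle W,\Gamma\rangle_{\mathbb{F}_q}\cap V$ where $W$ is a $t$-dimensional $\mathbb{F}_q$-subspace of $\mathbb{V}$ with $\langle W\rangle_{\mathbb{F}_{q^n}}=\mathbb{V}$ and $W\cap\Gamma=\{0\}$ (such an embedding always exists). Let $\beta':W\times W\to\mathbb{F}_q$ be a non-degenerate reflexive sesquilinear form, and let $\beta:\mathbb{V}\times\mathbb{V}\to\mathbb{F}_{q^n}$ be a non-degenerate reflexive sesquilinear form extending $\beta'$ (an $\mathbb{F}_q$-basis of $W$ is an $\mathbb{F}_{q^n}$-basis of $\mathbb{V}$). Let $\perp$ denote orthogonal complement in $\mathbb{V}$ with respect to $\beta$.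 The Delsarte dual of $U$ is the $\mathbb{F}_q$-subspace $\bar U=W+\Gamma^\perp$ of the quotient space $\mathbb{V}/\Gamma^\perp\cong V(t-r,q^n)$. *)

theory Defs
  imports "Jordan_Normal_Form.Missing_VectorSpace" "HOL-Algebra.Subrings" "HOL-Algebra.RingHom"
begin

text \<open>Throughout, \<open>K\<close> is a field, \<open>F\<close> (a subset of its carrier) a subfield, and an
  \<open>F\<close>-space structure on a \<open>K\<close>-space \<open>V\<close> is obtained by keeping \<open>V\<close> and shrinking the
  scalars to \<open>K\<lparr>carrier := F\<rparr>\<close>.\<close>

definition has_dim :: "('a, 'm) ring_scheme \<Rightarrow> ('a, 'b, 'n) module_scheme \<Rightarrow> nat \<Rightarrow> bool" where
  "has_dim K V m \<longleftrightarrow>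
     vectorspace K V \<and> vectorspace.fin_dim K V \<and> vectorspace.dim K V = m"

definition sub_dim :: "('a, 'm) ring_scheme \<Rightarrow> ('a, 'b, 'n) module_scheme \<Rightarrow> 'b set \<Rightarrow> nat" where
  "sub_dim K V W = vectorspace.dim K (V\<lparr>carrier := W\<rparr>)"


text \<open>\<open>(h,k)\<^sub>q\<close>-evasive \<open>F\<close>-subspaces of the \<open>K\<close>-space \<open>V\<close>, with \<open>q\<close> the order of \<open>F\<close>.\<close>

definition evasive ::
  "('a, 'm) ring_scheme \<Rightarrow> 'a set \<Rightarrow> ('a, 'b, 'n) module_scheme \<Rightarrow> nat \<Rightarrow> nat \<Rightarrow> 'b set \<Rightarrow> bool" where
  "evasive K F V h k U \<longleftrightarrow>
     0 < h \<and> 0 < k \<and>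
     VectorSpace.subspace (K\<lparr>carrier := F\<rparr>) U V \<and>
     h \<le> sub_dim K V (LinearCombinations.module.span K V U) \<and>
     (\<forall>H. VectorSpace.subspace K H V \<and> sub_dim K V H = h \<longrightarrow> sub_dim (K\<lparr>carrier := F\<rparr>) V (H \<inter> U) \<le> k)"


definition quotient_space ::
  "('a, 'b, 'n) module_scheme \<Rightarrow> 'b set \<Rightarrow> ('a, 'b set) module" where
  "quotient_space V N =
     \<lparr>carrier = a_rcosets\<^bsub>V\<^esub> N,
      monoid.mult = undefined, one = undefined, \<comment> \<open>not part of the module structure\<close>
      zero = N,
      add = (\<lambda>X Y. X <+>\<^bsub>V\<^esub> Y),
      smult = (\<lambda>a X. \<Union>x\<in>X. N +>\<^bsub>V\<^esub> (a \<odot>\<^bsub>V\<^esub> x))\<rparr>"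


lemma quotient_space_vectorspace:
  assumes V: "vectorspace K V" and N: "VectorSpace.subspace K N V"
  shows "vectorspace K (quotient_space V N)"
proof -
  interpret V: vectorspace K V by fact
  have sm: "LinearCombinations.submodule K N V" using N by (simp add: VectorSpace.subspace_def)
  interpret S: LinearCombinations.submodule K N V by fact
  have sg: "subgroup N (add_monoid V)"
  proof
    show "N \<subseteq> carrier (add_monoid V)" using S.subset by simp
  next
    fix x assume x: "x \<in> N"
    then have xV: "x \<in> carrier V" using S.subset by auto
    have "(\<ominus>\<^bsub>K\<^esub> \<one>\<^bsub>K\<^esub>) \<odot>\<^bsub>V\<^esub> x = \<ominus>\<^bsub>V\<^esub> x" using xV by (simp add: V.smult_l_minus)
    moreover have "(\<ominus>\<^bsub>K\<^esub> \<one>\<^bsub>K\<^esub>) \<odot>\<^bsub>V\<^esub> x \<in> N" using x by auto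
    ultimately show "inv\<^bsub>add_monoid V\<^esub> x \<in> N" by (simp add: a_inv_def)
  qed auto
  have ab: "abelian_subgroup N V"
    by (intro abelian_subgroupI3 additive_subgroup.intro sg) (rule V.abelian_group_axioms)
  interpret A: abelian_subgroup N V by fact
  have cos: "X \<in> a_rcosets\<^bsub>V\<^esub> N \<longleftrightarrow> (\<exists>x\<in>carrier V. X = N +>\<^bsub>V\<^esub> x)" for X
    by (auto simp: A_RCOSETS_defs a_r_coset_def r_coset_def)
  have add: "(N +>\<^bsub>V\<^esub> x) <+>\<^bsub>V\<^esub> (N +>\<^bsub>V\<^esub> y) = N +>\<^bsub>V\<^esub> (x \<oplus>\<^bsub>V\<^esub> y)" if "x\<in>carrier V" "y\<in>carrier V" for x y
    using that by (rule A.a_rcos_sum)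
  have mem: "z \<in> N +>\<^bsub>V\<^esub> x \<longleftrightarrow> (\<exists>n\<in>N. z = n \<oplus>\<^bsub>V\<^esub> x)" for x z
    by (auto simp: a_r_coset_def' )
  have eqc: "N +>\<^bsub>V\<^esub> (n \<oplus>\<^bsub>V\<^esub> x) = N +>\<^bsub>V\<^esub> x" if "n\<in>N" "x\<in>carrier V" for n x
    using V.a_repr_independence[of "n \<oplus>\<^bsub>V\<^esub> x" N x, OF _ _ sg] that mem by auto
  have smul: "(\<Union>y\<in>N +>\<^bsub>V\<^esub> x. N +>\<^bsub>V\<^esub> (a \<odot>\<^bsub>V\<^esub> y)) = N +>\<^bsub>V\<^esub> (a \<odot>\<^bsub>V\<^esub> x)"
    if a: "a \<in> carrier K" and x: "x \<in> carrier V" for a x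
  proof -
    have "N +>\<^bsub>V\<^esub> (a \<odot>\<^bsub>V\<^esub> y) = N +>\<^bsub>V\<^esub> (a \<odot>\<^bsub>V\<^esub> x)" if "y \<in> N +>\<^bsub>V\<^esub> x" for y
    proof -
      obtain n where n: "n \<in> N" "y = n \<oplus>\<^bsub>V\<^esub> x" using \<open>y \<in> _\<close> mem by auto
      have nV: "n \<in> carrier V" using n S.subset by auto
      have "a \<odot>\<^bsub>V\<^esub> y = a \<odot>\<^bsub>V\<^esub> n \<oplus>\<^bsub>V\<^esub> a \<odot>\<^bsub>V\<^esub> x"
        using n x nV a by (simp add: V.smult_r_distr)
      then show ?thesis using eqc[of "a \<odot>\<^bsub>V\<^esub> n" "a \<odot>\<^bsub>V\<^esub> x"] n a x by auto
    qed
    moreover have "x \<in> N +>\<^bsub>V\<^esub> x" using A.a_rcos_self x by auto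
    ultimately show ?thesis by blast
  qed
  have zero: "N = N +>\<^bsub>V\<^esub> \<zero>\<^bsub>V\<^esub>"
    using S.subset by (simp add: V.a_coset_add_zero)

  define Q where "Q = quotient_space V N"
  define c where "c x = N +>\<^bsub>V\<^esub> x" for x
  have Qc: "carrier Q = c ` carrier V" using cos by (auto simp: Q_def quotient_space_def c_def)
  have Qa: "c x \<oplus>\<^bsub>Q\<^esub> c y = c (x \<oplus>\<^bsub>V\<^esub> y)" if "x\<in>carrier V" "y\<in>carrier V" for x y
    using add that by (auto simp: Q_def quotient_space_def c_def)
  have Qs: "a \<odot>\<^bsub>Q\<^esub> c x = c (a \<odot>\<^bsub>V\<^esub> x)" if "a \<in> carrier K" "x\<in>carrier V" for a x
    using smul that by (auto simp: Q_def quotient_space_def c_def)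
  have Qz: "\<zero>\<^bsub>Q\<^esub> = c \<zero>\<^bsub>V\<^esub>" using zero by (auto simp: Q_def quotient_space_def c_def)
  have "vectorspace K Q"
  proof (rule vs_criteria)
    show "field K" by (rule V.field_axioms)
    show "\<forall>v\<in>carrier Q. \<exists>w\<in>carrier Q. v \<oplus>\<^bsub>Q\<^esub> w = \<zero>\<^bsub>Q\<^esub>"
      by (auto simp: Qc Qz Qa V.r_neg intro!: bexI[where x="\<ominus>\<^bsub>V\<^esub> _"])
  qed (auto simp: Qc Qz Qa Qs V.M.add.m_ac V.smult_l_distr V.smult_r_distr V.smult_assoc1)
  then show ?thesis by (simp add: Q_def)
qed


text \<open>Sesquilinear forms are linear in the first argument and semilinear, with respect to a
  field automorphism, in the second one.\<close>

definition sesquilinear_form ::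
  "('a, 'm) ring_scheme \<Rightarrow> ('a, 'b, 'n) module_scheme \<Rightarrow> ('b \<Rightarrow> 'b \<Rightarrow> 'a) \<Rightarrow> bool" where
  "sesquilinear_form K V b \<longleftrightarrow>
     (\<exists>\<sigma> \<in> ring_iso K K.
       (\<forall>x \<in> carrier V. \<forall>y \<in> carrier V. b x y \<in> carrier K) \<and>
       (\<forall>x \<in> carrier V. \<forall>y \<in> carrier V. \<forall>z \<in> carrier V.
          b (x \<oplus>\<^bsub>V\<^esub> y) z = b x z \<oplus>\<^bsub>K\<^esub> b y z \<and>
          b x (y \<oplus>\<^bsub>V\<^esub> z) = b x y \<oplus>\<^bsub>K\<^esub> b x z) \<and>
       (\<forall>a \<in> carrier K. \<forall>x \<in> carrier V. \<forall>y \<in> carrier V.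
          b (a \<odot>\<^bsub>V\<^esub> x) y = a \<otimes>\<^bsub>K\<^esub> b x y \<and>
          b x (a \<odot>\<^bsub>V\<^esub> y) = \<sigma> a \<otimes>\<^bsub>K\<^esub> b x y))"

definition reflexive_form ::
  "('a, 'm) ring_scheme \<Rightarrow> ('a, 'b, 'n) module_scheme \<Rightarrow> ('b \<Rightarrow> 'b \<Rightarrow> 'a) \<Rightarrow> bool" where
  "reflexive_form K V b \<longleftrightarrow>
     (\<forall>x \<in> carrier V. \<forall>y \<in> carrier V. b x y = \<zero>\<^bsub>K\<^esub> \<longrightarrow> b y x = \<zero>\<^bsub>K\<^esub>)"

text \<open>Only the left radical is mentioned; for reflexive forms it is also the right radical.\<close>

definition nondegenerate_form ::
  "('a, 'm) ring_scheme \<Rightarrow> ('a, 'b, 'n) module_scheme \<Rightarrow> ('b \<Rightarrow> 'b \<Rightarrow> 'a) \<Rightarrow> bool" where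
  "nondegenerate_form K V b \<longleftrightarrow>
     (\<forall>x \<in> carrier V. (\<forall>y \<in> carrier V. b x y = \<zero>\<^bsub>K\<^esub>) \<longrightarrow> x = \<zero>\<^bsub>V\<^esub>)"

definition nondeg_refl_sesq ::
  "('a, 'm) ring_scheme \<Rightarrow> ('a, 'b, 'n) module_scheme \<Rightarrow> ('b \<Rightarrow> 'b \<Rightarrow> 'a) \<Rightarrow> bool" where
  "nondeg_refl_sesq K V b \<longleftrightarrow>
     sesquilinear_form K V b \<and> reflexive_form K V b \<and> nondegenerate_form K V b"

definition orth_compl ::
  "('a, 'm) ring_scheme \<Rightarrow> ('a, 'b, 'n) module_scheme \<Rightarrow> ('b \<Rightarrow> 'b \<Rightarrow> 'a) \<Rightarrow> 'b set \<Rightarrow> 'b set" where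
  "orth_compl K V b S = {x \<in> carrier V. \<forall>y \<in> S. b x y = \<zero>\<^bsub>K\<^esub>}"


text \<open>The embedding of the \<open>r\<close>-dimensional \<open>K\<close>-space \<open>V\<close> as a subspace of the
  \<open>t\<close>-dimensional \<open>K\<close>-space \<open>VV\<close>, presenting the \<open>F\<close>-subspace \<open>U\<close> of \<open>V\<close> as the
  projection of \<open>W\<close> from the vertex \<open>\<Gamma>\<close>.\<close>

definition delsarte_embedding ::
  "('a, 'm) ring_scheme \<Rightarrow> 'a set \<Rightarrow> nat \<Rightarrow> nat \<Rightarrow> ('a, 'b, 'n) module_scheme \<Rightarrow>
     'b set \<Rightarrow> 'b set \<Rightarrow> 'b set \<Rightarrow> 'b set \<Rightarrow> bool" where
  "delsarte_embedding K F r t VV V \<Gamma> W U \<longleftrightarrow>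
     r < t \<and>
     has_dim K VV t \<and>
     VectorSpace.subspace K V VV \<and> has_dim K (VV\<lparr>carrier := V\<rparr>) r \<and>
     VectorSpace.subspace K \<Gamma> VV \<and> has_dim K (VV\<lparr>carrier := \<Gamma>\<rparr>) (t - r) \<and>
     V <+>\<^bsub>VV\<^esub> \<Gamma> = carrier VV \<and> V \<inter> \<Gamma> = {\<zero>\<^bsub>VV\<^esub>} \<and>
     VectorSpace.subspace (K\<lparr>carrier := F\<rparr>) U (VV\<lparr>carrier := V\<rparr>) \<and>
     has_dim (K\<lparr>carrier := F\<rparr>) (VV\<lparr>carrier := U\<rparr>) t \<and>
     VectorSpace.subspace (K\<lparr>carrier := F\<rparr>) W VV \<and>
     has_dim (K\<lparr>carrier := F\<rparr>) (VV\<lparr>carrier := W\<rparr>) t \<and>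
     LinearCombinations.module.span K VV W = carrier VV \<and> W \<inter> \<Gamma> = {\<zero>\<^bsub>VV\<^esub>} \<and>
     U = LinearCombinations.module.span (K\<lparr>carrier := F\<rparr>) VV (W \<union> \<Gamma>) \<inter> V"

definition delsarte_forms ::
  "('a, 'm) ring_scheme \<Rightarrow> 'a set \<Rightarrow> ('a, 'b, 'n) module_scheme \<Rightarrow> 'b set \<Rightarrow>
     ('b \<Rightarrow> 'b \<Rightarrow> 'a) \<Rightarrow> ('b \<Rightarrow> 'b \<Rightarrow> 'a) \<Rightarrow> bool" where
  "delsarte_forms K F VV W b' b \<longleftrightarrow>
     nondeg_refl_sesq (K\<lparr>carrier := F\<rparr>) (VV\<lparr>carrier := W\<rparr>) b' \<and>
     nondeg_refl_sesq K VV b \<and>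
     (\<forall>x \<in> W. \<forall>y \<in> W. b x y = b' x y)"

text \<open>\<open>W + N\<close> in \<open>VV / N\<close>, where \<open>N\<close> will be the orthogonal complement of \<open>\<Gamma>\<close>.\<close>

definition delsarte_dual ::
  "('a, 'b, 'n) module_scheme \<Rightarrow> 'b set \<Rightarrow> 'b set \<Rightarrow> 'b set set" where
  "delsarte_dual VV N W = (\<lambda>w. N +>\<^bsub>VV\<^esub> w) ` W"

end

theory Submission
  imports Defs
begin

text \<open>
  Let \<open>N = \<Gamma>\<^sup>\<perp>\<close>. Projecting from \<open>\<Gamma>\<close> turns evasiveness of \<open>U\<close> into a statement about \<open>W\<close>: an
  \<open>F\<close>-subspace of \<open>W\<close> contained in a \<open>K\<close>-subspace \<open>D \<supseteq> \<Gamma>\<close> with \<open>dim D \<le> t - r + h\<close> has dimension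
  at most \<open>k\<close>. For an \<open>F\<close>-subspace \<open>A\<close> of \<open>W\<close> with \<open>\<beta>'\<close>-orthogonal complement \<open>B\<close>, apply this to
  \<open>D = \<langle>\<Gamma>, B\<rangle>\<close>: since \<open>D\<^sup>\<perp>\<close> contains \<open>N \<inter> \<langle>A\<rangle>\<close>, the inequality \<open>dim (N \<inter> \<langle>A\<rangle>) \<ge> r - h\<close> bounds
  \<open>dim D\<close> by \<open>t - r + h\<close>, whence \<open>t - dim A \<le> dim B \<le> k\<close>. Both claims follow by contradiction:
  if \<open>X\<close> violates the bound, take \<open>A\<close> of dimension \<open>t - k - 1\<close> inside the preimage of \<open>X\<close> in \<open>W\<close>;
  if \<open>W \<inter> N\<close>, the kernel of \<open>W \<rightarrow> U'\<close>, is too large, take \<open>A\<close> of dimension \<open>r - h\<close> inside it.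
\<close>

section \<open>Dimensions of subspaces and quotients\<close>

lemma subspaceI:
  assumes "vectorspace K V" and "S \<subseteq> carrier V" and "\<zero>\<^bsub>V\<^esub> \<in> S"
    and "\<And>x y. x \<in> S \<Longrightarrow> y \<in> S \<Longrightarrow> x \<oplus>\<^bsub>V\<^esub> y \<in> S"
    and "\<And>a x. a \<in> carrier K \<Longrightarrow> x \<in> S \<Longrightarrow> a \<odot>\<^bsub>V\<^esub> x \<in> S"
  shows "VectorSpace.subspace K S V"
  using assms unfolding VectorSpace.subspace_def submodule_def vectorspace_def by auto

lemma subspaceD:
  assumes "VectorSpace.subspace K S V"
  shows "S \<subseteq> carrier V" and "\<zero>\<^bsub>V\<^esub> \<in> S"
    and "x \<in> S \<Longrightarrow> y \<in> S \<Longrightarrow> x \<oplus>\<^bsub>V\<^esub> y \<in> S"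
    and "a \<in> carrier K \<Longrightarrow> x \<in> S \<Longrightarrow> a \<odot>\<^bsub>V\<^esub> x \<in> S"
  using assms unfolding VectorSpace.subspace_def submodule_def by auto

lemma subspace_in_carrier: "VectorSpace.subspace K S V \<Longrightarrow> x \<in> S \<Longrightarrow> x \<in> carrier V"
  using subspaceD(1) by blast

lemma subspace_Int:
  assumes "VectorSpace.subspace K S V" and "VectorSpace.subspace K T V"
  shows "VectorSpace.subspace K (S \<inter> T) V"
  using assms unfolding VectorSpace.subspace_def submodule_def by auto

context vectorspace
begin

lemma subspace_carrier: "VectorSpace.subspace K (carrier V) V"
  by (rule subspaceI) (auto intro: vectorspace_axioms)

lemma subspace_span_subset:
  assumes "VectorSpace.subspace K T V" and "S \<subseteq> T"
  shows "span S \<subseteq> T"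
  using assms span_is_subset is_module by blast

lemma subspace_uminus:
  assumes S: "VectorSpace.subspace K S V" and x: "x \<in> S"
  shows "\<ominus>\<^bsub>V\<^esub> x \<in> S"
proof -
  have "\<ominus>\<^bsub>V\<^esub> x = (\<ominus>\<^bsub>K\<^esub> \<one>\<^bsub>K\<^esub>) \<odot>\<^bsub>V\<^esub> x"
    using subspace_in_carrier[OF S x] by (simp add: smult_l_minus)
  then show ?thesis using subspaceD(4)[OF S _ x] by simp
qed

text \<open>Moves between ambient spaces: \<open>U\<close> is given inside \<open>V\<close>, and
  \<open>\<beta>'\<close> lives on \<open>W\<close> as a space of its own, whereas all dimensions
  are compared inside \<open>VV\<close>.\<close>

lemma subspace_nested_iff:
  assumes T: "VectorSpace.subspace K T V"
  shows "VectorSpace.subspace K S (V\<lparr>carrier := T\<rparr>) \<longleftrightarrow> VectorSpace.subspace K S V \<and> S \<subseteq> T"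
proof
  assume S: "VectorSpace.subspace K S (V\<lparr>carrier := T\<rparr>)"
  have "S \<subseteq> T" using subspaceD(1)[OF S] by simp
  moreover have "VectorSpace.subspace K S V"
    using subspaceD[OF S] subspaceD(1)[OF T] by (intro subspaceI vectorspace_axioms) auto
  ultimately show "VectorSpace.subspace K S V \<and> S \<subseteq> T" by simp
next
  assume "VectorSpace.subspace K S V \<and> S \<subseteq> T"
  then show "VectorSpace.subspace K S (V\<lparr>carrier := T\<rparr>)"
    using subspaceD[of K S V] by (intro subspaceI subspace_is_vs[OF T]) auto
qed

section \<open>Bases and dimensions of subspaces\<close>

lemma basis_of_span:
  assumes B: "B \<subseteq> carrier V" and li: "lin_indpt B"
  shows "vectorspace.basis K (vs (span B)) B"
proof -
  have sub: "VectorSpace.subspace K (span B) V" by (rule span_is_subspace[OF B])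
  interpret S: vectorspace K "vs (span B)" by (rule subspace_is_vs[OF sub])
  have "B \<subseteq> span B" by (rule in_own_span[OF B])
  then show ?thesis unfolding S.basis_def
    using span_li_not_depend[OF _ is_module[OF sub], of B] li by simp
qed

lemma sub_dim_span_indpt:
  assumes B: "B \<subseteq> carrier V" and li: "lin_indpt B" and fin: "finite B"
  shows "sub_dim K V (span B) = card B"
proof -
  interpret S: vectorspace K "vs (span B)" by (rule subspace_is_vs[OF span_is_subspace[OF B]])
  show ?thesis unfolding sub_dim_def using S.dim_basis[OF fin basis_of_span[OF B li]] .
qed

lemma sub_dim_span_le:
  assumes B: "B \<subseteq> carrier V" and fin: "finite B"
  shows "sub_dim K V (span B) \<le> card B"
proof -
  have sub: "VectorSpace.subspace K (span B) V" by (rule span_is_subspace[OF B])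
  interpret S: vectorspace K "vs (span B)" by (rule subspace_is_vs[OF sub])
  have "B \<subseteq> span B" by (rule in_own_span[OF B])
  then show ?thesis unfolding sub_dim_def
    using S.gen_ge_dim[OF fin] span_li_not_depend(1)[OF _ is_module[OF sub], of B] by simp
qed

lemma sub_dim_carrier [simp]: "sub_dim K V (carrier V) = dim"
  by (simp add: sub_dim_def)

lemma sub_dim_zero [simp]: "sub_dim K V {\<zero>\<^bsub>V\<^esub>} = 0"
  using sub_dim_span_le[of "{}"] by (simp add: span_empty)

text \<open>Independent sets have at most \<open>dim\<close> elements, so a maximal independent
  \<open>C\<close> with \<open>B \<subseteq> C \<subseteq> T\<close> exists. A vector of
  \<open>T\<close> outside \<open>span C\<close> could be added to \<open>C\<close>, against
  maximality.\<close>

lemma extend_to_basis: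
  assumes fd: "fin_dim" and T: "VectorSpace.subspace K T V"
    and B: "B \<subseteq> T" and li: "lin_indpt B"
  obtains C where "B \<subseteq> C" "C \<subseteq> T" "finite C" "lin_indpt C" "span C = T"
proof -
  have TV: "T \<subseteq> carrier V" by (rule subspaceD(1)[OF T])
  obtain C where C: "maximal C (\<lambda>C. B \<subseteq> C \<and> C \<subseteq> T \<and> lin_indpt C)" and fin: "finite C"
    using maximal_exists[of "\<lambda>C. B \<subseteq> C \<and> C \<subseteq> T \<and> lin_indpt C" dim B] B li li_le_dim[OF fd] TV
    by blast
  have C': "B \<subseteq> C" "C \<subseteq> T" "lin_indpt C" using C by (auto simp: maximal_def)
  have "v \<in> span C" if v: "v \<in> T" for v
  proof (rule ccontr)
    assume nv: "v \<notin> span C"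
    then have vC: "v \<notin> C" using in_own_span[of C] C' TV by auto
    then have "lin_indpt (C \<union> {v})" using lin_dep_iff_in_span[of C v] nv C' TV v by auto
    then have "C \<union> {v} = C" using C C' v by (auto simp: maximal_def)
    then show False using vC by auto
  qed
  moreover have "span C \<subseteq> T" by (rule subspace_span_subset[OF T C'(2)])
  ultimately have "span C = T" by auto
  then show thesis using that[of C] C' fin by blast
qed

lemma subspace_basis_exists:
  assumes fd: "fin_dim" and T: "VectorSpace.subspace K T V"
  obtains B where "B \<subseteq> T" "finite B" "lin_indpt B" "span B = T" "card B = sub_dim K V T"
proof -
  have "lin_indpt {}" by (simp add: lin_dep_def)
  then obtain B where B: "B \<subseteq> T" "finite B" "lin_indpt B" "span B = T"
    using extend_to_basis[OF fd T, of "{}"] by blast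
  moreover have "card B = sub_dim K V T"
    using sub_dim_span_indpt[of B] B subspaceD(1)[OF T] by auto
  ultimately show thesis using that by blast
qed

text \<open>A basis of \<open>S\<close> extends to a basis of \<open>T\<close>; any set of
  \<open>m\<close> vectors between the two bases is independent and spans the required
  \<open>M\<close>.\<close>

lemma sub_dim_intermediate:
  assumes fd: "fin_dim" and S: "VectorSpace.subspace K S V" and T: "VectorSpace.subspace K T V"
    and ST: "S \<subseteq> T"
  shows sub_dim_mono: "sub_dim K V S \<le> sub_dim K V T"
    and subspace_between: "sub_dim K V S \<le> m \<Longrightarrow> m \<le> sub_dim K V T \<Longrightarrow>
      \<exists>M. VectorSpace.subspace K M V \<and> S \<subseteq> M \<and> M \<subseteq> T \<and> sub_dim K V M = m"
proof -
  have TV: "T \<subseteq> carrier V" by (rule subspaceD(1)[OF T])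
  obtain B where B: "B \<subseteq> S" "finite B" "lin_indpt B" "span B = S" "card B = sub_dim K V S"
    using subspace_basis_exists[OF fd S] by blast
  obtain C where C: "B \<subseteq> C" "C \<subseteq> T" "finite C" "lin_indpt C" "span C = T"
    using extend_to_basis[OF fd T, of B] B ST by blast
  have cC: "card C = sub_dim K V T" using sub_dim_span_indpt[of C] C TV by auto
  show "sub_dim K V S \<le> sub_dim K V T" using card_mono[OF C(3,1)] B cC by simp
  assume "sub_dim K V S \<le> m" "m \<le> sub_dim K V T"
  then obtain D where D: "B \<subseteq> D" "D \<subseteq> C" "card D = m"
    using exists_subset_between[of B m C] B C cC by metis
  have DV: "D \<subseteq> carrier V" using D C TV by auto
  have "lin_indpt D" using C(4) D(2) unfolding lin_dep_def by blast
  then have "sub_dim K V (span D) = m"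
    using sub_dim_span_indpt[OF DV] D C(3) finite_subset by blast
  moreover have "span D \<subseteq> T" using subspace_span_subset[OF T] D C by blast
  moreover have "S \<subseteq> span D" using span_is_monotone[OF D(1)] B(4) by simp
  ultimately show "\<exists>M. VectorSpace.subspace K M V \<and> S \<subseteq> M \<and> M \<subseteq> T \<and> sub_dim K V M = m"
    using span_is_subspace[OF DV] by blast
qed

lemma subspace_of_dim:
  assumes fd: "fin_dim" and T: "VectorSpace.subspace K T V" and m: "m \<le> sub_dim K V T"
  obtains M where "VectorSpace.subspace K M V" "M \<subseteq> T" "sub_dim K V M = m"
proof -
  have "VectorSpace.subspace K {\<zero>\<^bsub>V\<^esub>} V" using span_is_subspace[of "{}"] by (simp add: span_empty)
  then show thesis using subspace_between[OF fd _ T, of "{\<zero>\<^bsub>V\<^esub>}" m] subspaceD(2)[OF T] m that by auto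
qed

section \<open>Finite dimension, and finiteness over a finite field\<close>

lemma fin_dim_subspace:
  assumes fd: "fin_dim" and T: "VectorSpace.subspace K T V"
  shows "vectorspace.fin_dim K (vs T)"
proof -
  interpret T: vectorspace K "vs T" by (rule subspace_is_vs[OF T])
  obtain B where "B \<subseteq> T" "finite B" "span B = T" using subspace_basis_exists[OF fd T] by blast
  then show ?thesis unfolding T.fin_dim_def
    using span_li_not_depend(1)[OF _ is_module[OF T], of B] by auto
qed

lemma finite_carrier_fin_dim: "finite (carrier V) \<Longrightarrow> fin_dim"
  unfolding fin_dim_def using in_own_span[of "carrier V"] span_is_subset2[of "carrier V"] by blast

lemma fin_dim_finite_carrier:
  assumes fd: "fin_dim" and fin: "finite (carrier K)"
  shows "finite (carrier V)"
proof -
  obtain A where A: "finite A" "A \<subseteq> carrier V" "span A = carrier V"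
    using fd unfolding fin_dim_def by blast
  have "carrier V \<subseteq> (\<lambda>a. lincomb a A) ` (A \<rightarrow>\<^sub>E carrier K)"
  proof
    fix x assume "x \<in> carrier V"
    then obtain a where a: "a \<in> A \<rightarrow> carrier K" "x = lincomb a A"
      using finite_span[OF A(1,2)] A(3) by auto
    then have "x = lincomb (restrict a A) A" using lincomb_restrict[OF A(2) a(1), of "restrict a A"] by simp
    then show "x \<in> (\<lambda>a. lincomb a A) ` (A \<rightarrow>\<^sub>E carrier K)" using a by auto
  qed
  then show ?thesis using finite_PiE[of A "\<lambda>_. carrier K"] A(1) fin finite_subset by blast
qed

text \<open>If \<open>f\<close> does not vanish on \<open>S\<close>, a single vector
  \<open>v\<close> with \<open>f v\<close> nonzero together with a basis of the kernel spans
  \<open>S\<close>. Linearity is asked on \<open>S\<close> only, so that \<open>f\<close> may be a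
  form with its second argument fixed.\<close>

lemma functional_kernel_dim:
  assumes fd: "fin_dim" and S: "VectorSpace.subspace K S V"
    and f: "\<And>x. x \<in> S \<Longrightarrow> f x \<in> carrier K"
    and add: "\<And>x y. x \<in> S \<Longrightarrow> y \<in> S \<Longrightarrow> f (x \<oplus>\<^bsub>V\<^esub> y) = f x \<oplus>\<^bsub>K\<^esub> f y"
    and scal: "\<And>a x. a \<in> carrier K \<Longrightarrow> x \<in> S \<Longrightarrow> f (a \<odot>\<^bsub>V\<^esub> x) = a \<otimes>\<^bsub>K\<^esub> f x"
  defines "H \<equiv> {x \<in> S. f x = \<zero>\<^bsub>K\<^esub>}"
  shows "VectorSpace.subspace K H V" and "sub_dim K V S \<le> sub_dim K V H + 1"
proof -
  have SV: "\<And>x. x \<in> S \<Longrightarrow> x \<in> carrier V" using subspace_in_carrier[OF S] .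
  have f0: "f \<zero>\<^bsub>V\<^esub> = \<zero>\<^bsub>K\<^esub>" using scal[of "\<zero>\<^bsub>K\<^esub>" "\<zero>\<^bsub>V\<^esub>"] f subspaceD(2)[OF S] by simp
  show H: "VectorSpace.subspace K H V"
    using subspaceD[OF S] f0 by (intro subspaceI vectorspace_axioms) (auto simp: H_def add scal)
  show "sub_dim K V S \<le> sub_dim K V H + 1"
  proof (cases "H = S")
    case False
    then obtain v where v: "v \<in> S" "f v \<noteq> \<zero>\<^bsub>K\<^esub>" by (auto simp: H_def)
    have fvu: "f v \<in> Units K" using v f field_Units by auto
    obtain B where B: "B \<subseteq> H" "finite B" "span B = H" "card B = sub_dim K V H"
      using subspace_basis_exists[OF fd H] by blast
    have BV: "insert v B \<subseteq> carrier V" using B H v subspaceD(1) SV by blast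
    have "S \<subseteq> span (insert v B)"
    proof
      fix x assume x: "x \<in> S"
      \<comment> \<open>This quotient is the scalar for which \<open>x - a v\<close> lies in the
        kernel \<open>H\<close>.\<close>
      define a where "a = f x \<otimes>\<^bsub>K\<^esub> inv\<^bsub>K\<^esub> (f v)"
      have a: "a \<in> carrier K" using fvu f x by (simp add: a_def)
      have af: "a \<otimes>\<^bsub>K\<^esub> f v = f x" using fvu f x v by (simp add: a_def m_assoc)
      have av: "\<ominus>\<^bsub>V\<^esub> (a \<odot>\<^bsub>V\<^esub> v) = (\<ominus>\<^bsub>K\<^esub> a) \<odot>\<^bsub>V\<^esub> v" using a SV[OF v(1)] by (simp add: smult_l_minus)
      have avS: "\<ominus>\<^bsub>V\<^esub> (a \<odot>\<^bsub>V\<^esub> v) \<in> S" using av subspaceD(4)[OF S _ v(1)] a by simp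
      have "f (x \<oplus>\<^bsub>V\<^esub> \<ominus>\<^bsub>V\<^esub> (a \<odot>\<^bsub>V\<^esub> v)) = f x \<oplus>\<^bsub>K\<^esub> (\<ominus>\<^bsub>K\<^esub> a) \<otimes>\<^bsub>K\<^esub> f v"
        using add[OF x avS] scal[OF _ v(1), of "\<ominus>\<^bsub>K\<^esub> a"] a av by simp
      also have "\<dots> = \<zero>\<^bsub>K\<^esub>" using af a f[OF v(1)] f[OF x] by (simp add: l_minus R.r_neg)
      finally have "x \<oplus>\<^bsub>V\<^esub> \<ominus>\<^bsub>V\<^esub> (a \<odot>\<^bsub>V\<^esub> v) \<in> H"
        using subspaceD(3)[OF S x avS] by (simp add: H_def)
      then have "x \<oplus>\<^bsub>V\<^esub> \<ominus>\<^bsub>V\<^esub> (a \<odot>\<^bsub>V\<^esub> v) \<in> span (insert v B)"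
        using span_is_monotone[of B "insert v B"] B(3) by auto
      moreover have "a \<odot>\<^bsub>V\<^esub> v \<in> span (insert v B)"
        using subspaceD(4)[OF span_is_subspace[OF BV] a] in_own_span[OF BV] by blast
      ultimately have "x \<oplus>\<^bsub>V\<^esub> \<ominus>\<^bsub>V\<^esub> (a \<odot>\<^bsub>V\<^esub> v) \<oplus>\<^bsub>V\<^esub> a \<odot>\<^bsub>V\<^esub> v \<in> span (insert v B)"
        using subspaceD(3)[OF span_is_subspace[OF BV]] by blast
      moreover have "x \<oplus>\<^bsub>V\<^esub> \<ominus>\<^bsub>V\<^esub> (a \<odot>\<^bsub>V\<^esub> v) \<oplus>\<^bsub>V\<^esub> a \<odot>\<^bsub>V\<^esub> v = x"
        using SV[OF x] SV[OF v(1)] a by (simp add: M.a_assoc M.l_neg)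
      ultimately show "x \<in> span (insert v B)" by simp
    qed
    then have "sub_dim K V S \<le> sub_dim K V (span (insert v B))"
      by (rule sub_dim_mono[OF fd S span_is_subspace[OF BV]])
    also have "\<dots> \<le> card (insert v B)" using sub_dim_span_le[OF BV] B(2) by simp
    also have "\<dots> \<le> card B + 1" by (simp add: card_insert_le_m1 B(2) card_insert_if)
    finally show ?thesis using B(4) by simp
  qed simp
qed

end

section \<open>Rank-nullity and quotient spaces\<close>

lemma (in linear_map) rank_nullity_subspace:
  assumes fd: "V.fin_dim" and S: "VectorSpace.subspace K S V"
  shows "VectorSpace.subspace K (T ` S) W"
    and "sub_dim K W (T ` S) + sub_dim K V {x \<in> S. T x = \<zero>\<^bsub>W\<^esub>} = sub_dim K V S"
proof -
  have SV: "S \<subseteq> carrier V" by (rule subspaceD(1)[OF S])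
  have vS: "vectorspace K (V\<lparr>carrier := S\<rparr>)" by (rule V.subspace_is_vs[OF S])
  have "T \<in> LinearCombinations.module_hom K (V\<lparr>carrier := S\<rparr>) W" 
    unfolding LinearCombinations.module_hom_def using subsetD[OF SV] by auto
  then interpret S: linear_map K "V\<lparr>carrier := S\<rparr>" W T
    using vS W.vectorspace_axioms
    by (simp add: linear_map_def mod_hom_def mod_hom_axioms_def vectorspace_def)
  have im: "S.im = T ` S" by (simp add: S.im_def)
  have ker: "S.ker = {x \<in> S. T x = \<zero>\<^bsub>W\<^esub>}" by (simp add: S.ker_def)
  show "VectorSpace.subspace K (T ` S) W" using S.imT_is_subspace im by simp
  show "sub_dim K W (T ` S) + sub_dim K V {x \<in> S. T x = \<zero>\<^bsub>W\<^esub>} = sub_dim K V S"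
    using S.rank_nullity[OF V.fin_dim_subspace[OF fd S]] im ker by (simp add: sub_dim_def)
qed

context vectorspace
begin

text \<open>The structure \<open>quotient_space V N\<close> does not mention the scalars, so one and
  the same quotient serves as a \<open>K\<close>-space and, with \<open>K\<close> replaced by its
  subfield, as an \<open>F\<close>-space.\<close>

lemma quotient_linear_map:
  assumes N: "VectorSpace.subspace K N V"
  shows "linear_map K V (quotient_space V N) (\<lambda>x. N +>\<^bsub>V\<^esub> x)"
    and "x \<in> carrier V \<Longrightarrow> N +>\<^bsub>V\<^esub> x = \<zero>\<^bsub>quotient_space V N\<^esub> \<longleftrightarrow> x \<in> N"
    and "(\<lambda>x. N +>\<^bsub>V\<^esub> x) ` carrier V = carrier (quotient_space V N)"
proof -
  have NV: "N \<subseteq> carrier V" by (rule subspaceD(1)[OF N])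
  have sg: "subgroup N (add_monoid V)"
    using subspaceD[OF N] subspace_uminus[OF N] by unfold_locales (auto simp: a_inv_def)
  interpret A: abelian_subgroup N V
    by (intro abelian_subgroupI3 additive_subgroup.intro sg) (rule abelian_group_axioms)
  have cos: "N +>\<^bsub>V\<^esub> (n \<oplus>\<^bsub>V\<^esub> x) = N +>\<^bsub>V\<^esub> x" if "n \<in> N" "x \<in> carrier V" for n x
    using a_repr_independence[of "n \<oplus>\<^bsub>V\<^esub> x" N x, OF _ _ sg] that by (auto simp: a_r_coset_def')
  \<comment> \<open>Scalar multiplication in the quotient is a union over all representatives. Two
    representatives differ by an element of \<open>N\<close>, and so do their multiples, so the
    union is a single coset.\<close>
  have smult: "(\<Union>y\<in>N +>\<^bsub>V\<^esub> x. N +>\<^bsub>V\<^esub> (a \<odot>\<^bsub>V\<^esub> y)) = N +>\<^bsub>V\<^esub> (a \<odot>\<^bsub>V\<^esub> x)"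
    if a: "a \<in> carrier K" and x: "x \<in> carrier V" for a x
  proof -
    have "N +>\<^bsub>V\<^esub> (a \<odot>\<^bsub>V\<^esub> y) = N +>\<^bsub>V\<^esub> (a \<odot>\<^bsub>V\<^esub> x)" if y: "y \<in> N +>\<^bsub>V\<^esub> x" for y
    proof -
      obtain n where n: "n \<in> N" "y = n \<oplus>\<^bsub>V\<^esub> x" using y by (auto simp: a_r_coset_def')
      then have "a \<odot>\<^bsub>V\<^esub> y = a \<odot>\<^bsub>V\<^esub> n \<oplus>\<^bsub>V\<^esub> a \<odot>\<^bsub>V\<^esub> x"
        using a x NV by (auto simp: smult_r_distr)
      then show ?thesis using cos[of "a \<odot>\<^bsub>V\<^esub> n" "a \<odot>\<^bsub>V\<^esub> x"] subspaceD(4)[OF N a n(1)] a x by simp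
    qed
    moreover have "x \<in> N +>\<^bsub>V\<^esub> x" using A.a_rcos_self x by auto
    ultimately show ?thesis by blast
  qed
  show im: "(\<lambda>x. N +>\<^bsub>V\<^esub> x) ` carrier V = carrier (quotient_space V N)"
    by (auto simp: quotient_space_def A_RCOSETS_defs a_r_coset_def r_coset_def)
  have "(\<lambda>x. N +>\<^bsub>V\<^esub> x) \<in> LinearCombinations.module_hom K V (quotient_space V N)"
    unfolding LinearCombinations.module_hom_def im[symmetric]
    by (auto simp: quotient_space_def A.a_rcos_sum smult)
  then show "linear_map K V (quotient_space V N) (\<lambda>x. N +>\<^bsub>V\<^esub> x)"
    using vectorspace_axioms quotient_space_vectorspace[OF vectorspace_axioms N]
    by (simp add: linear_map_def mod_hom_def mod_hom_axioms_def vectorspace_def)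
  show "x \<in> carrier V \<Longrightarrow> N +>\<^bsub>V\<^esub> x = \<zero>\<^bsub>quotient_space V N\<^esub> \<longleftrightarrow> x \<in> N"
    using a_coset_join1[OF _ _ sg, of x] a_coset_join2[OF _ sg, of x]
    by (auto simp: quotient_space_def)
qed

lemma quotient_fin_dim:
  assumes "fin_dim" and N: "VectorSpace.subspace K N V"
  shows "vectorspace.fin_dim K (quotient_space V N)"
proof -
  interpret Q: linear_map K V "quotient_space V N" "\<lambda>x. N +>\<^bsub>V\<^esub> x"
    by (rule quotient_linear_map(1)[OF N])
  show ?thesis by (rule Q.surj_fin_dim[OF assms(1) quotient_linear_map(3)[OF N]])
qed

lemma quotient_image:
  assumes fd: "fin_dim" and N: "VectorSpace.subspace K N V" and S: "VectorSpace.subspace K S V"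
  shows "VectorSpace.subspace K ((\<lambda>x. N +>\<^bsub>V\<^esub> x) ` S) (quotient_space V N)"
    and "sub_dim K (quotient_space V N) ((\<lambda>x. N +>\<^bsub>V\<^esub> x) ` S) + sub_dim K V (S \<inter> N) = sub_dim K V S"
proof -
  interpret Q: linear_map K V "quotient_space V N" "\<lambda>x. N +>\<^bsub>V\<^esub> x"
    by (rule quotient_linear_map(1)[OF N])
  have "{x \<in> S. N +>\<^bsub>V\<^esub> x = \<zero>\<^bsub>quotient_space V N\<^esub>} = S \<inter> N"
    using quotient_linear_map(2)[OF N] subspaceD(1)[OF S] by blast
  then show "sub_dim K (quotient_space V N) ((\<lambda>x. N +>\<^bsub>V\<^esub> x) ` S) + sub_dim K V (S \<inter> N) = sub_dim K V S"
    using Q.rank_nullity_subspace(2)[OF fd S] by simp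
  show "VectorSpace.subspace K ((\<lambda>x. N +>\<^bsub>V\<^esub> x) ` S) (quotient_space V N)"
    by (rule Q.rank_nullity_subspace(1)[OF fd S])
qed

text \<open>Half of the dimension formula, with any \<open>X\<close> containing both subspaces in
  place of their sum: modulo \<open>T\<close>, the image of \<open>S\<close> lies in the image of
  \<open>X\<close>.\<close>

lemma sub_dim_add_le:
  assumes fd: "fin_dim" and S: "VectorSpace.subspace K S V" and T: "VectorSpace.subspace K T V"
    and X: "VectorSpace.subspace K X V" and SX: "S \<subseteq> X" and TX: "T \<subseteq> X"
  shows "sub_dim K V S + sub_dim K V T \<le> sub_dim K V X + sub_dim K V (S \<inter> T)"
proof -
  interpret Q: vectorspace K "quotient_space V T"
    by (rule quotient_space_vectorspace[OF vectorspace_axioms T])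
  have "sub_dim K (quotient_space V T) ((\<lambda>x. T +>\<^bsub>V\<^esub> x) ` S)
      \<le> sub_dim K (quotient_space V T) ((\<lambda>x. T +>\<^bsub>V\<^esub> x) ` X)"
    using SX by (intro Q.sub_dim_mono quotient_fin_dim quotient_image fd S T X image_mono)
  moreover have "X \<inter> T = T" using TX by blast
  ultimately show ?thesis using quotient_image(2)[OF fd T S] quotient_image(2)[OF fd T X] by simp
qed

text \<open>The projection is onto, so it maps \<open>P\<close> onto all of \<open>X\<close>, and
  its kernel \<open>N\<close> lies in \<open>P\<close>; rank-nullity on \<open>P\<close> gives the
  dimension.\<close>

lemma quotient_vimage:
  assumes fd: "fin_dim" and N: "VectorSpace.subspace K N V"
    and X: "VectorSpace.subspace K X (quotient_space V N)"
  defines "P \<equiv> {x \<in> carrier V. N +>\<^bsub>V\<^esub> x \<in> X}"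
  shows "VectorSpace.subspace K P V" and "N \<subseteq> P"
    and "sub_dim K V P = sub_dim K (quotient_space V N) X + sub_dim K V N"
proof -
  interpret Q: linear_map K V "quotient_space V N" "\<lambda>x. N +>\<^bsub>V\<^esub> x"
    by (rule quotient_linear_map(1)[OF N])
  show P: "VectorSpace.subspace K P V"
    using subspaceD[OF X] Q.T0_is_0
    by (intro subspaceI vectorspace_axioms) (auto simp: P_def)
  show NP: "N \<subseteq> P"
    using quotient_linear_map(2)[OF N] subspaceD(1)[OF N] subspaceD(2)[OF X] by (force simp: P_def)
  have "X \<subseteq> (\<lambda>x. N +>\<^bsub>V\<^esub> x) ` carrier V"
    using quotient_linear_map(3)[OF N] subspaceD(1)[OF X] by simp
  then have "(\<lambda>x. N +>\<^bsub>V\<^esub> x) ` P = X"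
    unfolding P_def by blast
  moreover have "P \<inter> N = N" using NP by blast
  ultimately show "sub_dim K V P = sub_dim K (quotient_space V N) X + sub_dim K V N"
    using quotient_image(2)[OF fd N P] by simp
qed

end

section \<open>Sesquilinear forms\<close>

context vectorspace
begin

text \<open>In the second argument only the preservation of zeros under scaling is kept. This hides
  the automorphism \<open>\<sigma>\<close> and suffices for orthogonality.\<close>

lemma sesquilinear_formD:
  assumes "sesquilinear_form K V b"
  shows "x \<in> carrier V \<Longrightarrow> y \<in> carrier V \<Longrightarrow> b x y \<in> carrier K"
    and "x \<in> carrier V \<Longrightarrow> y \<in> carrier V \<Longrightarrow> z \<in> carrier V \<Longrightarrow> b (x \<oplus>\<^bsub>V\<^esub> y) z = b x z \<oplus>\<^bsub>K\<^esub> b y z"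
    and "x \<in> carrier V \<Longrightarrow> y \<in> carrier V \<Longrightarrow> z \<in> carrier V \<Longrightarrow> b x (y \<oplus>\<^bsub>V\<^esub> z) = b x y \<oplus>\<^bsub>K\<^esub> b x z"
    and "a \<in> carrier K \<Longrightarrow> x \<in> carrier V \<Longrightarrow> y \<in> carrier V \<Longrightarrow> b (a \<odot>\<^bsub>V\<^esub> x) y = a \<otimes>\<^bsub>K\<^esub> b x y"
    and "a \<in> carrier K \<Longrightarrow> x \<in> carrier V \<Longrightarrow> y \<in> carrier V \<Longrightarrow> b x y = \<zero>\<^bsub>K\<^esub> \<Longrightarrow> b x (a \<odot>\<^bsub>V\<^esub> y) = \<zero>\<^bsub>K\<^esub>"
proof -
  obtain \<sigma> where s: "\<sigma> \<in> ring_iso K K"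
    and 1: "\<forall>x \<in> carrier V. \<forall>y \<in> carrier V. b x y \<in> carrier K"
    and 2: "\<forall>x \<in> carrier V. \<forall>y \<in> carrier V. \<forall>z \<in> carrier V.
          b (x \<oplus>\<^bsub>V\<^esub> y) z = b x z \<oplus>\<^bsub>K\<^esub> b y z \<and> b x (y \<oplus>\<^bsub>V\<^esub> z) = b x y \<oplus>\<^bsub>K\<^esub> b x z"
    and 3: "\<forall>a \<in> carrier K. \<forall>x \<in> carrier V. \<forall>y \<in> carrier V.
          b (a \<odot>\<^bsub>V\<^esub> x) y = a \<otimes>\<^bsub>K\<^esub> b x y \<and> b x (a \<odot>\<^bsub>V\<^esub> y) = \<sigma> a \<otimes>\<^bsub>K\<^esub> b x y"
    using assms unfolding sesquilinear_form_def by blast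
  show "x \<in> carrier V \<Longrightarrow> y \<in> carrier V \<Longrightarrow> b x y \<in> carrier K" using 1 by blast
  show "x \<in> carrier V \<Longrightarrow> y \<in> carrier V \<Longrightarrow> z \<in> carrier V \<Longrightarrow> b (x \<oplus>\<^bsub>V\<^esub> y) z = b x z \<oplus>\<^bsub>K\<^esub> b y z"
    and "x \<in> carrier V \<Longrightarrow> y \<in> carrier V \<Longrightarrow> z \<in> carrier V \<Longrightarrow> b x (y \<oplus>\<^bsub>V\<^esub> z) = b x y \<oplus>\<^bsub>K\<^esub> b x z"
    using 2 by blast+
  show "a \<in> carrier K \<Longrightarrow> x \<in> carrier V \<Longrightarrow> y \<in> carrier V \<Longrightarrow> b (a \<odot>\<^bsub>V\<^esub> x) y = a \<otimes>\<^bsub>K\<^esub> b x y"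
    using 3 by blast
  show "a \<in> carrier K \<Longrightarrow> x \<in> carrier V \<Longrightarrow> y \<in> carrier V \<Longrightarrow> b x y = \<zero>\<^bsub>K\<^esub> \<Longrightarrow> b x (a \<odot>\<^bsub>V\<^esub> y) = \<zero>\<^bsub>K\<^esub>"
    using 3 ring_iso_memE(1)[OF s] by simp
qed

lemma orth_compl_subspace:
  assumes b: "sesquilinear_form K V b" and Y: "Y \<subseteq> carrier V"
  shows "VectorSpace.subspace K (orth_compl K V b Y) V"
proof (rule subspaceI[OF vectorspace_axioms])
  note b = sesquilinear_formD[OF b]
  have "b \<zero>\<^bsub>V\<^esub> y = \<zero>\<^bsub>K\<^esub>" if "y \<in> carrier V" for y
    using b(4)[of "\<zero>\<^bsub>K\<^esub>" "\<zero>\<^bsub>V\<^esub>" y] b(1)[of "\<zero>\<^bsub>V\<^esub>" y] that by simp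
  then show "\<zero>\<^bsub>V\<^esub> \<in> orth_compl K V b Y" using Y by (auto simp: orth_compl_def)
  show "x \<oplus>\<^bsub>V\<^esub> y \<in> orth_compl K V b Y"
    if "x \<in> orth_compl K V b Y" "y \<in> orth_compl K V b Y" for x y
    using that b(2) Y by (auto simp: orth_compl_def subset_iff)
  show "a \<odot>\<^bsub>V\<^esub> x \<in> orth_compl K V b Y" if "a \<in> carrier K" "x \<in> orth_compl K V b Y" for a x
    using that b(4) Y by (auto simp: orth_compl_def subset_iff)
qed (auto simp: orth_compl_def)

text \<open>For fixed \<open>x\<close>, the vectors \<open>y\<close> with \<open>b x y\<close> zero
  form a subspace, although \<open>b x\<close> is merely semilinear; if it contains
  \<open>Y\<close>, it contains \<open>span Y\<close>.\<close>

lemma orth_compl_span: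
  assumes b: "sesquilinear_form K V b" and Y: "Y \<subseteq> carrier V"
  shows "orth_compl K V b (span Y) = orth_compl K V b Y"
proof
  note b = sesquilinear_formD[OF b]
  show "orth_compl K V b (span Y) \<subseteq> orth_compl K V b Y"
    using in_own_span[OF Y] by (auto simp: orth_compl_def)
  have "b x y = \<zero>\<^bsub>K\<^esub>" if x: "x \<in> orth_compl K V b Y" and y: "y \<in> span Y" for x y
  proof -
    have xV: "x \<in> carrier V" using x by (simp add: orth_compl_def)
    \<comment> \<open>Additivity makes the value at zero equal to its own double; cancellation makes
      it zero.\<close>
    have "b x \<zero>\<^bsub>V\<^esub> \<oplus>\<^bsub>K\<^esub> b x \<zero>\<^bsub>V\<^esub> = b x \<zero>\<^bsub>V\<^esub>" using b(3)[of x "\<zero>\<^bsub>V\<^esub>" "\<zero>\<^bsub>V\<^esub>"] xV by simp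
    then have "b x \<zero>\<^bsub>V\<^esub> = \<zero>\<^bsub>K\<^esub>" using b(1)[of x "\<zero>\<^bsub>V\<^esub>"] xV
      by (metis R.add.l_cancel_one M.zero_closed)
    then have "VectorSpace.subspace K {y \<in> carrier V. b x y = \<zero>\<^bsub>K\<^esub>} V"
      using xV b(3,5) by (intro subspaceI vectorspace_axioms) auto
    moreover have "Y \<subseteq> {y \<in> carrier V. b x y = \<zero>\<^bsub>K\<^esub>}" using x Y by (auto simp: orth_compl_def)
    ultimately show ?thesis using subspace_span_subset y by blast
  qed
  then show "orth_compl K V b Y \<subseteq> orth_compl K V b (span Y)" by (auto simp: orth_compl_def)
qed

section \<open>Dimensions of orthogonal complements\<close>

lemma orth_compl_Un: "orth_compl K V b (Y \<union> Z) = orth_compl K V b Y \<inter> orth_compl K V b Z"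
  by (auto simp: orth_compl_def)

text \<open>Each \<open>y\<close> in \<open>Y\<close> imposes one linear condition on the first
  argument of \<open>b\<close> and so costs at most one dimension.\<close>

lemma sub_dim_le_orth_compl_Int:
  assumes fd: "fin_dim" and b: "sesquilinear_form K V b"
    and S: "VectorSpace.subspace K S V" and Y: "Y \<subseteq> carrier V" and fin: "finite Y"
  shows "sub_dim K V S \<le> sub_dim K V (S \<inter> orth_compl K V b Y) + card Y"
  using fin Y
proof (induction Y rule: finite_induct)
  case empty
  have "S \<inter> orth_compl K V b {} = S" using subspaceD(1)[OF S] by (auto simp: orth_compl_def)
  then show ?case by simp
next
  case (insert y Y)
  note bD = sesquilinear_formD[OF b]
  let ?T = "S \<inter> orth_compl K V b Y"
  have T: "VectorSpace.subspace K ?T V"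
    using insert.prems by (intro subspace_Int S orth_compl_subspace b) simp
  have TV: "?T \<subseteq> carrier V" by (rule subspaceD(1)[OF T])
  have "sub_dim K V ?T \<le> sub_dim K V {x \<in> ?T. b x y = \<zero>\<^bsub>K\<^esub>} + 1"
    using bD(1,2,4) insert.prems subsetD[OF TV] by (intro functional_kernel_dim(2) fd T) auto
  moreover have "{x \<in> ?T. b x y = \<zero>\<^bsub>K\<^esub>} = S \<inter> orth_compl K V b (insert y Y)"
    by (auto simp: orth_compl_def)
  ultimately show ?case using insert by simp
qed

lemma dim_le_orth_compl:
  assumes fd: "fin_dim" and b: "sesquilinear_form K V b" and D: "VectorSpace.subspace K D V"
  shows "dim \<le> sub_dim K V (orth_compl K V b D) + sub_dim K V D"
proof -
  obtain B where B: "B \<subseteq> D" "finite B" "span B = D" "card B = sub_dim K V D"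
    using subspace_basis_exists[OF fd D] by blast
  have BV: "B \<subseteq> carrier V" using B(1) subspaceD(1)[OF D] by simp
  have "carrier V \<inter> orth_compl K V b B = orth_compl K V b D"
    using orth_compl_span[OF b BV] B(3) by (auto simp: orth_compl_def)
  then show ?thesis
    using sub_dim_le_orth_compl_Int[OF fd b subspace_carrier BV B(2)] B(4) by simp
qed

text \<open>Extend a basis \<open>B\<close> of the complement of \<open>D\<close> to a basis
  \<open>C\<close> of \<open>V\<close>. By reflexivity every vector of \<open>D\<close> is
  orthogonal to \<open>B\<close>; one that is also orthogonal to \<open>C - B\<close> is orthogonal
  to everything, hence zero. So the \<open>card (C - B)\<close> conditions cut \<open>D\<close> down
  to zero, which bounds the dimension of \<open>D\<close>.\<close>

lemma orth_compl_le_dim: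
  assumes fd: "fin_dim" and b: "nondeg_refl_sesq K V b" and D: "VectorSpace.subspace K D V"
  shows "sub_dim K V (orth_compl K V b D) + sub_dim K V D \<le> dim"
proof -
  have sesq: "sesquilinear_form K V b" and refl: "reflexive_form K V b"
    and nondeg: "nondegenerate_form K V b"
    using b by (auto simp: nondeg_refl_sesq_def)
  let ?Z = "orth_compl K V b D"
  have DV: "D \<subseteq> carrier V" by (rule subspaceD(1)[OF D])
  have Z: "VectorSpace.subspace K ?Z V" by (rule orth_compl_subspace[OF sesq DV])
  obtain B where B: "B \<subseteq> ?Z" "finite B" "lin_indpt B" "span B = ?Z" "card B = sub_dim K V ?Z"
    using subspace_basis_exists[OF fd Z] by blast
  have "B \<subseteq> carrier V" using B(1) subspaceD(1)[OF Z] by simp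
  then obtain C where C: "B \<subseteq> C" "C \<subseteq> carrier V" "finite C" "lin_indpt C" "span C = carrier V"
    using extend_to_basis[OF fd subspace_carrier _ B(3)] by blast
  have cC: "card C = dim" using sub_dim_span_indpt[OF C(2,4,3)] C(5) by simp
  have "D \<inter> orth_compl K V b (C - B) \<subseteq> {\<zero>\<^bsub>V\<^esub>}"
  proof
    fix x assume x: "x \<in> D \<inter> orth_compl K V b (C - B)"
    have xV: "x \<in> carrier V" using x DV by auto
    have "b x y = \<zero>\<^bsub>K\<^esub>" if "y \<in> ?Z" for y
      using that x xV refl by (auto simp: orth_compl_def reflexive_form_def)
    then have "x \<in> orth_compl K V b C" using x B(1) by (auto simp: orth_compl_def)
    then have "x \<in> orth_compl K V b (carrier V)" using orth_compl_span[OF sesq C(2)] C(5) by simp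
    then show "x \<in> {\<zero>\<^bsub>V\<^esub>}"
      using nondeg xV by (auto simp: orth_compl_def nondegenerate_form_def)
  qed
  moreover have "\<zero>\<^bsub>V\<^esub> \<in> D \<inter> orth_compl K V b (C - B)"
    using C(2) by (intro subspaceD(2)[OF subspace_Int[OF D orth_compl_subspace[OF sesq]]]) auto
  ultimately have "D \<inter> orth_compl K V b (C - B) = {\<zero>\<^bsub>V\<^esub>}" by blast
  then have "sub_dim K V D \<le> card (C - B)"
    using sub_dim_le_orth_compl_Int[OF fd sesq D, of "C - B"] C(2,3) by auto
  moreover have "card (C - B) = card C - card B" "card B \<le> card C"
    using card_Diff_subset[OF B(2) C(1)] card_mono[OF C(3,1)] by auto
  ultimately show ?thesis using cC B(5) by linarith
qed

end

section \<open>Restriction of scalars\<close>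

lemma vectorspace_restrict_scalars:
  assumes V: "vectorspace K V" and F: "subfield F K"
  shows "vectorspace (K\<lparr>carrier := F\<rparr>) V"
proof -
  interpret V: vectorspace K V by fact
  have FK: "F \<subseteq> carrier K" by (rule subfieldE(3)[OF F])
  show ?thesis
  proof (rule vs_criteria)
    show "field (K\<lparr>carrier := F\<rparr>)" by (rule V.subfield_iff(2)[OF F])
    show "\<forall>v\<in>carrier V. \<exists>w\<in>carrier V. v \<oplus>\<^bsub>V\<^esub> w = \<zero>\<^bsub>V\<^esub>"
      using V.M.r_neg by blast
  qed (use FK in \<open>auto simp: subset_iff V.M.a_assoc V.smult_l_distr V.smult_r_distr V.smult_assoc1
    intro: V.M.a_comm\<close>)
qed

lemma subspace_restrict_scalars:
  assumes S: "VectorSpace.subspace K S V" and F: "subfield F K"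
  shows "VectorSpace.subspace (K\<lparr>carrier := F\<rparr>) S V"
  using subspaceD[OF S] subfieldE(3)[OF F] S
  by (intro subspaceI vectorspace_restrict_scalars[OF _ F]) (auto simp: VectorSpace.subspace_def)

text \<open>An \<open>F\<close>-basis of \<open>W\<close> spans \<open>VV\<close> over
  \<open>K\<close> and has \<open>dim\<close> elements, so it is a \<open>K\<close>-basis. Choosing
  it to extend an \<open>F\<close>-basis of \<open>A\<close> shows that the latter stays independent
  over \<open>K\<close>.\<close>

lemma sub_dim_restrict_scalars_le:
  assumes V: "vectorspace K V" and F: "subfield F K"
    and fdK: "vectorspace.fin_dim K V" and fdF: "vectorspace.fin_dim (K\<lparr>carrier := F\<rparr>) V"
    and W: "VectorSpace.subspace (K\<lparr>carrier := F\<rparr>) W V"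
    and dimW: "sub_dim (K\<lparr>carrier := F\<rparr>) V W = vectorspace.dim K V"
    and spanW: "LinearCombinations.module.span K V W = carrier V"
    and A: "VectorSpace.subspace (K\<lparr>carrier := F\<rparr>) A V" and AW: "A \<subseteq> W"
  shows "sub_dim (K\<lparr>carrier := F\<rparr>) V A \<le> sub_dim K V (LinearCombinations.module.span K V A)"
proof -
  interpret V: vectorspace K V by fact
  interpret F: vectorspace "K\<lparr>carrier := F\<rparr>" V by (rule vectorspace_restrict_scalars[OF V F])
  obtain B where B: "B \<subseteq> A" "finite B" "F.lin_indpt B" "card B = sub_dim (K\<lparr>carrier := F\<rparr>) V A"
    using F.subspace_basis_exists[OF fdF A] by metis
  obtain C where C: "B \<subseteq> C" "C \<subseteq> W" "finite C" "F.lin_indpt C" "F.span C = W"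
    using F.extend_to_basis[OF fdF W _ B(3)] B(1) AW by blast
  have AV: "A \<subseteq> carrier V" and WV: "W \<subseteq> carrier V" using subspaceD(1) A W by blast+
  then have CV: "C \<subseteq> carrier V" using C(2) by simp
  have sC: "VectorSpace.subspace K (V.span C) V" by (rule V.span_is_subspace[OF CV])
  have "card C = V.dim" using F.sub_dim_span_indpt[OF CV C(4,3)] C(5) dimW by simp
  moreover have "V.span C = carrier V"
  proof -
    have "F.span C \<subseteq> V.span C"
      using F.subspace_span_subset[OF subspace_restrict_scalars[OF sC F] V.in_own_span[OF CV]] .
    then have "V.span W \<subseteq> V.span C" using V.subspace_span_subset[OF sC] C(5) by simp
    then show ?thesis using spanW subspaceD(1)[OF sC] by simp
  qed
  ultimately have "V.basis C" using V.dim_gen_is_basis[OF C(3) CV] by simp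
  then have "V.lin_indpt B" using C(1) unfolding V.basis_def V.lin_dep_def by blast
  then have "card B = sub_dim K V (V.span B)"
    using V.sub_dim_span_indpt[of B] B(1,2) AV by simp
  also have "\<dots> \<le> sub_dim K V (V.span A)"
    using B(1) AV by (intro V.sub_dim_mono fdK V.span_is_subspace V.span_is_monotone) auto
  finally show ?thesis using B(4) by simp
qed

section \<open>The Delsarte dual\<close>

lemma has_dim_subspaceD:
  assumes "has_dim K (V\<lparr>carrier := S\<rparr>) m"
  shows "sub_dim K V S = m"
  using assms by (simp add: has_dim_def sub_dim_def)

lemma delsarte_embedding_facts:
  assumes fin: "finite (carrier K)" and F: "subfield F K"
    and emb: "delsarte_embedding K F r t VV V \<Gamma> W U"
  shows "vectorspace K VV" and "vectorspace (K\<lparr>carrier := F\<rparr>) VV"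
    and "vectorspace.fin_dim K VV" and "vectorspace.fin_dim (K\<lparr>carrier := F\<rparr>) VV"
    and "vectorspace.dim K VV = t" and "r < t"
    and "VectorSpace.subspace K V VV" and "VectorSpace.subspace K \<Gamma> VV"
    and "VectorSpace.subspace (K\<lparr>carrier := F\<rparr>) W VV"
    and "VectorSpace.subspace (K\<lparr>carrier := F\<rparr>) U VV" and "U \<subseteq> V"
    and "sub_dim K VV V = r" and "sub_dim K VV \<Gamma> = t - r"
    and "sub_dim (K\<lparr>carrier := F\<rparr>) VV W = t"
    and "V \<inter> \<Gamma> = {\<zero>\<^bsub>VV\<^esub>}" and "W \<inter> \<Gamma> = {\<zero>\<^bsub>VV\<^esub>}"
    and "LinearCombinations.module.span K VV W = carrier VV"
proof -
  let ?E = "K\<lparr>carrier := F\<rparr>"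
  note e = emb[unfolded delsarte_embedding_def]
  show VV: "vectorspace K VV" using e by (simp add: has_dim_def)
  then interpret V: vectorspace K VV .
  show "vectorspace ?E VV" by (rule vectorspace_restrict_scalars[OF VV F])
  then interpret F: vectorspace ?E VV .
  show fd: "V.fin_dim" and "V.dim = t" using e by (simp_all add: has_dim_def)
  \<comment> \<open>Over \<open>F\<close>, finite dimension of \<open>VV\<close> comes from its
    finiteness as a set: it is finite-dimensional over the finite field \<open>K\<close>.\<close>
  show "F.fin_dim" by (rule F.finite_carrier_fin_dim[OF V.fin_dim_finite_carrier[OF fd fin]])
  show "r < t" and Vs: "VectorSpace.subspace K V VV" and "VectorSpace.subspace K \<Gamma> VV"
    and "VectorSpace.subspace ?E W VV" using e by simp_all
  have "VectorSpace.subspace ?E V VV" by (rule subspace_restrict_scalars[OF Vs F])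
  then show "VectorSpace.subspace ?E U VV" and "U \<subseteq> V"
    using e F.subspace_nested_iff by blast+
  show "sub_dim K VV V = r" and "sub_dim K VV \<Gamma> = t - r"
    and "sub_dim ?E VV W = t"
    using e by (simp_all add: has_dim_subspaceD)
  show "V \<inter> \<Gamma> = {\<zero>\<^bsub>VV\<^esub>}" and "W \<inter> \<Gamma> = {\<zero>\<^bsub>VV\<^esub>}"
    and "V.span W = carrier VV" using e by simp_all
qed

section \<open>Consequences of evasiveness, read in the ambient space \<open>VV\<close>\<close>

lemma evasive_subspace_boundD:
  assumes V: "vectorspace K VV" and S: "VectorSpace.subspace K V VV"
    and ev: "evasive K F (VV\<lparr>carrier := V\<rparr>) h k U"
    and H: "VectorSpace.subspace K H VV" and HV: "H \<subseteq> V" and dimH: "sub_dim K VV H = h"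
  shows "sub_dim (K\<lparr>carrier := F\<rparr>) VV (H \<inter> U) \<le> k"
proof -
  interpret V: vectorspace K VV by fact
  have "VectorSpace.subspace K H (VV\<lparr>carrier := V\<rparr>)" using V.subspace_nested_iff[OF S] H HV by simp
  then show ?thesis using ev dimH by (auto simp: evasive_def sub_dim_def)
qed

text \<open>Evasiveness includes a lower bound \<open>h\<close> on the dimension of the span of
  \<open>U\<close>, and that span lies in \<open>V\<close>. This leaves room for
  \<open>h\<close>-dimensional subspaces of \<open>V\<close>.\<close>

lemma evasive_le_dim:
  assumes V: "vectorspace K VV" and fd: "vectorspace.fin_dim K VV"
    and S: "VectorSpace.subspace K V VV"
    and ev: "evasive K F (VV\<lparr>carrier := V\<rparr>) h k U"
    and UV: "U \<subseteq> V"
  shows "h \<le> sub_dim K VV V"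
proof -
  interpret V: vectorspace K VV by fact
  have U: "U \<subseteq> carrier VV" using UV subspaceD(1)[OF S] by simp
  have "h \<le> sub_dim K (VV\<lparr>carrier := V\<rparr>) (LinearCombinations.module.span K (VV\<lparr>carrier := V\<rparr>) U)"
    using ev by (simp add: evasive_def)
  also have "\<dots> = sub_dim K VV (V.span U)"
    using V.span_li_not_depend(1)[OF UV V.is_module[OF S]] by (simp add: sub_dim_def)
  also have "\<dots> \<le> sub_dim K VV V"
    by (intro V.sub_dim_mono fd V.span_is_subspace U S V.subspace_span_subset UV)
  finally show ?thesis .
qed

text \<open>The only place where the evasion bound on \<open>U\<close> is applied. Both claims of
  the theorem arise by choosing an \<open>A\<close> that satisfies \<open>large\<close> but is too
  small for the conclusion.\<close>

lemma orth_compl_Int_span_dim_bound: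
  assumes fin: "finite (carrier K)" and F: "subfield F K"
    and emb: "delsarte_embedding K F r t VV V \<Gamma> W U"
    and forms: "delsarte_forms K F VV W \<beta>' \<beta>"
    and ev: "evasive K F (VV\<lparr>carrier := V\<rparr>) h k U"
    and N: "N = orth_compl K VV \<beta> \<Gamma>"
    and A: "VectorSpace.subspace (K\<lparr>carrier := F\<rparr>) A VV" and AW: "A \<subseteq> W"
    and large: "r \<le> h + sub_dim K VV (N \<inter> LinearCombinations.module.span K VV A)"
  shows "t \<le> sub_dim (K\<lparr>carrier := F\<rparr>) VV A + k"
proof -
  let ?E = "K\<lparr>carrier := F\<rparr>"
  note facts = delsarte_embedding_facts[OF fin F emb]
  note vsK = facts(1) and vsF = facts(2) and fdK = facts(3) and fdF = facts(4)
    and dimVV = facts(5) and rt = facts(6) and subV = facts(7) and \<Gamma> = facts(8)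
    and W = facts(9) and subU = facts(10) and UV = facts(11) and dim\<Gamma> = facts(13)
    and dimW = facts(14) and V\<Gamma> = facts(15) and W\<Gamma> = facts(16)
  interpret V: vectorspace K VV by (rule vsK)
  interpret F: vectorspace ?E VV by (rule vsF)
  interpret W: vectorspace ?E "VV\<lparr>carrier := W\<rparr>" by (rule F.subspace_is_vs[OF W])
  have b: "nondeg_refl_sesq K VV \<beta>" and b': "nondeg_refl_sesq ?E (VV\<lparr>carrier := W\<rparr>) \<beta>'"
    and ext: "\<And>x y. x \<in> W \<Longrightarrow> y \<in> W \<Longrightarrow> \<beta> x y = \<beta>' x y"
    using forms by (auto simp: delsarte_forms_def)
  have sesq: "sesquilinear_form K VV \<beta>" and refl: "reflexive_form K VV \<beta>"
    using b by (simp_all add: nondeg_refl_sesq_def)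
  have sesq': "sesquilinear_form ?E (VV\<lparr>carrier := W\<rparr>) \<beta>'"
    using b' by (simp add: nondeg_refl_sesq_def)
  have WV: "W \<subseteq> carrier VV" and \<Gamma>V: "\<Gamma> \<subseteq> carrier VV" using W \<Gamma> subspaceD(1) by blast+

  \<comment> \<open>The complement is taken inside \<open>W\<close> for \<open>\<beta>'\<close>, so
    that its dimension is counted over \<open>F\<close>: it is at least \<open>t\<close> minus that
    of \<open>A\<close>.\<close>
  define B where "B = orth_compl ?E (VV\<lparr>carrier := W\<rparr>) \<beta>' A"
  have AW': "VectorSpace.subspace ?E A (VV\<lparr>carrier := W\<rparr>)"
    using F.subspace_nested_iff[OF W] A AW by simp
  have "VectorSpace.subspace ?E B (VV\<lparr>carrier := W\<rparr>)"
    unfolding B_def using AW by (intro W.orth_compl_subspace sesq') simp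
  then have B: "VectorSpace.subspace ?E B VV" and BW: "B \<subseteq> W"
    using F.subspace_nested_iff[OF W] by simp_all
  have BV: "B \<subseteq> carrier VV" using BW WV by simp
  have "W.dim = t" using dimW by (simp add: sub_dim_def)
  then have dimB: "t \<le> sub_dim ?E VV B + sub_dim ?E VV A"
    using W.dim_le_orth_compl[OF F.fin_dim_subspace[OF fdF W] sesq' AW']
    by (simp add: sub_dim_def B_def)

  define D where "D = V.span (\<Gamma> \<union> B)"
  have D: "VectorSpace.subspace K D VV" unfolding D_def
    using \<Gamma>V BV by (intro V.span_is_subspace) simp
  have "\<Gamma> \<union> B \<subseteq> D" unfolding D_def using \<Gamma>V BV by (intro V.in_own_span) simp
  then have \<Gamma>D: "\<Gamma> \<subseteq> D" and BD: "B \<subseteq> D" by simp_all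
  have orthD: "orth_compl K VV \<beta> D = N \<inter> orth_compl K VV \<beta> B"
    unfolding D_def N using \<Gamma>V BV by (simp add: V.orth_compl_span[OF sesq] V.orth_compl_Un)
  \<comment> \<open>On \<open>W\<close> the form \<open>\<beta>\<close> agrees with
    \<open>\<beta>'\<close>; reflexivity exchanges the two sides of the orthogonality that defines
    \<open>B\<close>.\<close>
  have "A \<subseteq> orth_compl K VV \<beta> B"
  proof
    fix a assume a: "a \<in> A"
    have "\<beta> a y = \<zero>\<^bsub>K\<^esub>" if y: "y \<in> B" for y
    proof -
      have "\<beta> y a = \<zero>\<^bsub>K\<^esub>" using y a AW BW ext[of y a] by (auto simp: B_def orth_compl_def)
      then show ?thesis using refl a y AW WV BV unfolding reflexive_form_def by blast
    qed
    then show "a \<in> orth_compl K VV \<beta> B" using a AW WV by (auto simp: orth_compl_def)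
  qed
  then have "V.span A \<subseteq> orth_compl K VV \<beta> B"
    by (rule V.subspace_span_subset[OF V.orth_compl_subspace[OF sesq BV]])
  then have "N \<inter> V.span A \<subseteq> orth_compl K VV \<beta> D" using orthD by blast
  then have "sub_dim K VV (N \<inter> V.span A) \<le> sub_dim K VV (orth_compl K VV \<beta> D)"
    unfolding N using AW WV subspaceD(1)[OF D] \<Gamma>V
    by (intro V.sub_dim_mono fdK subspace_Int V.orth_compl_subspace[OF sesq] V.span_is_subspace) auto
  \<comment> \<open>The complement of \<open>D\<close> has dimension at least \<open>r - h\<close>,
    hence \<open>D\<close> has dimension at most \<open>t - r + h\<close>. As \<open>D\<close>
    contains \<open>\<Gamma>\<close>, which meets \<open>V\<close> trivially, at most
    \<open>h\<close> is left for \<open>V \<inter> D\<close>.\<close>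
  then have "r + sub_dim K VV D \<le> h + t"
    using V.orth_compl_le_dim[OF fdK b D] dimVV large by linarith
  moreover have "sub_dim K VV (V \<inter> D) + sub_dim K VV \<Gamma> \<le> sub_dim K VV D + sub_dim K VV (V \<inter> D \<inter> \<Gamma>)"
    using \<Gamma>D by (intro V.sub_dim_add_le fdK subspace_Int subV \<Gamma> D) auto
  moreover have "V \<inter> D \<inter> \<Gamma> = {\<zero>\<^bsub>VV\<^esub>}" using V\<Gamma> subspaceD(2)[OF D] by blast
  ultimately have VD: "sub_dim K VV (V \<inter> D) \<le> h" using rt dim\<Gamma> by simp
  have "h \<le> sub_dim K VV V" by (rule evasive_le_dim[OF vsK fdK subV ev UV])
  \<comment> \<open>Evasiveness speaks of subspaces of dimension exactly \<open>h\<close>, so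
    \<open>V \<inter> D\<close> is enlarged inside \<open>V\<close>.\<close>
  then obtain H where H: "VectorSpace.subspace K H VV" "V \<inter> D \<subseteq> H" "H \<subseteq> V" "sub_dim K VV H = h"
    using V.subspace_between[OF fdK subspace_Int[OF subV D] subV _ VD] by blast
  have HU: "sub_dim ?E VV (H \<inter> U) \<le> k"
    by (rule evasive_subspace_boundD[OF vsK subV ev H(1,3,4)])

  \<comment> \<open>The quotient by \<open>\<Gamma>\<close> plays the role of the projection onto
    \<open>V\<close> from the vertex \<open>\<Gamma>\<close>; over \<open>F\<close> it compares
    \<open>B\<close> with \<open>H \<inter> U\<close>.\<close>
  let ?Q = "quotient_space VV \<Gamma>" and ?p = "\<lambda>x. \<Gamma> +>\<^bsub>VV\<^esub> x"
  have \<Gamma>F: "VectorSpace.subspace ?E \<Gamma> VV" by (rule subspace_restrict_scalars[OF \<Gamma> F])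
  interpret p: linear_map ?E VV ?Q ?p by (rule F.quotient_linear_map(1)[OF \<Gamma>F])
  have HF: "VectorSpace.subspace ?E (H \<inter> U) VV"
    by (intro subspace_Int subspace_restrict_scalars[OF H(1) F] subU)
  have pB: "?p ` B \<subseteq> ?p ` (H \<inter> U)"
  proof (intro image_subsetI)
    fix x assume x: "x \<in> B"
    have xV: "x \<in> carrier VV" using x BV by blast
    have "V <+>\<^bsub>VV\<^esub> \<Gamma> = carrier VV" using emb by (simp add: delsarte_embedding_def)
    \<comment> \<open>The component \<open>v\<close> is the projection of \<open>x\<close> to
      \<open>V\<close>. Being \<open>x - g\<close>, it lies in \<open>D\<close> and in the
      \<open>F\<close>-span of \<open>W \<union> \<Gamma>\<close>, hence in
      \<open>V \<inter> D\<close> and in \<open>U\<close>.\<close>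
    then obtain v g where vg: "v \<in> V" "g \<in> \<Gamma>" "x = v \<oplus>\<^bsub>VV\<^esub> g"
      using xV unfolding set_add_def' by blast
    have vV: "v \<in> carrier VV" and gV: "g \<in> carrier VV"
      using vg subspaceD(1)[OF subV] \<Gamma>V by auto
    have v: "v = x \<oplus>\<^bsub>VV\<^esub> \<ominus>\<^bsub>VV\<^esub> g" using vg(3) vV gV by (simp add: V.M.a_assoc V.M.r_neg)
    have mg: "\<ominus>\<^bsub>VV\<^esub> g \<in> \<Gamma>" by (rule V.subspace_uminus[OF \<Gamma> vg(2)])
    have "v \<in> D" unfolding v using subspaceD(3)[OF D] x BD \<Gamma>D mg by blast
    moreover have "v \<in> F.span (W \<union> \<Gamma>)"
    proof -
      have sub: "W \<union> \<Gamma> \<subseteq> carrier VV" using WV \<Gamma>V by simp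
      show ?thesis unfolding v using x BW mg F.in_own_span[OF sub]
        by (intro subspaceD(3)[OF F.span_is_subspace[OF sub]]) auto
    qed
    moreover have "U = F.span (W \<union> \<Gamma>) \<inter> V" using emb by (simp add: delsarte_embedding_def)
    ultimately have "v \<in> H \<inter> U" using vg(1) H(2) by blast
    moreover have "?p x = ?p v"
    proof -
      have "?p g = \<zero>\<^bsub>?Q\<^esub>" using F.quotient_linear_map(2)[OF \<Gamma>F gV] vg(2) by simp
      then show ?thesis using vg(3) vV gV p.T_im[of v] by simp
    qed
    ultimately show "?p x \<in> ?p ` (H \<inter> U)" by blast
  qed
  \<comment> \<open>Since \<open>W\<close> avoids the vertex, the projection is injective on
    \<open>B\<close>, so \<open>B\<close> is no larger than \<open>H \<inter> U\<close>.\<close>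
  have "B \<inter> \<Gamma> = {\<zero>\<^bsub>VV\<^esub>}" using BW W\<Gamma> subspaceD(2)[OF B] subspaceD(2)[OF \<Gamma>] by blast
  then have "sub_dim ?E VV B = sub_dim ?E ?Q (?p ` B)"
    using F.quotient_image(2)[OF fdF \<Gamma>F B] by simp
  also have "\<dots> \<le> sub_dim ?E ?Q (?p ` (H \<inter> U))"
    by (intro p.W.sub_dim_mono F.quotient_fin_dim F.quotient_image(1) fdF \<Gamma>F B HF pB)
  also have "\<dots> \<le> sub_dim ?E VV (H \<inter> U)" using F.quotient_image(2)[OF fdF \<Gamma>F HF] by simp
  finally show ?thesis using dimB HU by linarith
qed

section \<open>Intersections with the dual, and its dimension\<close>

theorem theorem3p5:
  fixes K :: "('a, 'm) ring_scheme" and F :: "'a set" and q n r t h k :: nat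
    and VV :: "('a, 'b, 'n) module_scheme" and V \<Gamma> W U :: "'b set"
    and \<beta>' \<beta> :: "'b \<Rightarrow> 'b \<Rightarrow> 'a"
  assumes "field K" and "finite (carrier K)" and "subfield F K"
    and "card F = q" and "card (carrier K) = q ^ n"
    and "delsarte_embedding K F r t VV V \<Gamma> W U"
    and "delsarte_forms K F VV W \<beta>' \<beta>"
    and "evasive K F (VV\<lparr>carrier := V\<rparr>) h k U"
    and "k < t - r + h - 1"
    and "N = orth_compl K VV \<beta> \<Gamma>"
    and "Q = quotient_space VV N"
    and "U' = delsarte_dual VV N W"
  shows "(\<forall>X. VectorSpace.subspace K X Q \<and> sub_dim K Q X = t - r + h - k - 1 \<longrightarrow>
            VectorSpace.subspace (K\<lparr>carrier := F\<rparr>) (X \<inter> U') Q \<and>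
            sub_dim (K\<lparr>carrier := F\<rparr>) Q (X \<inter> U') \<le> t - k - 2) \<and>
         (t - r + h - k - 1 \<le> sub_dim K Q (LinearCombinations.module.span K Q U') \<longrightarrow>
            evasive K F Q (t - r + h - k - 1) (t - k - 2) U' \<and>
            t - r + h + 1 \<le> sub_dim (K\<lparr>carrier := F\<rparr>) Q U')"
proof -
  let ?E = "K\<lparr>carrier := F\<rparr>"
  note F = assms(3) and emb = assms(6) and forms = assms(7) and ev = assms(8) and k = assms(9)
    and N = assms(10) and Q = assms(11) and U' = assms(12)
  note facts = delsarte_embedding_facts[OF assms(2) F emb]
  note vsK = facts(1) and vsF = facts(2) and fdK = facts(3) and fdF = facts(4)
    and dimVV = facts(5) and rt = facts(6) and subV = facts(7) and \<Gamma> = facts(8)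
    and W = facts(9) and UV = facts(11) and dimV = facts(12) and dim\<Gamma> = facts(13)
    and dimW = facts(14) and spanW = facts(17)
  note bound = orth_compl_Int_span_dim_bound[OF assms(2) F emb forms ev N]
  interpret V: vectorspace K VV by (rule vsK)
  interpret F: vectorspace ?E VV by (rule vsF)
  have WV: "W \<subseteq> carrier VV" and \<Gamma>V: "\<Gamma> \<subseteq> carrier VV" using W \<Gamma> subspaceD(1) by blast+
  have b: "nondeg_refl_sesq K VV \<beta>" using forms by (simp add: delsarte_forms_def)
  then have sesq: "sesquilinear_form K VV \<beta>" by (simp add: nondeg_refl_sesq_def)
  have NK: "VectorSpace.subspace K N VV" unfolding N by (rule V.orth_compl_subspace[OF sesq \<Gamma>V])
  have NF: "VectorSpace.subspace ?E N VV" by (rule subspace_restrict_scalars[OF NK F])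
  \<comment> \<open>The two inequalities for complements combine to the exact value
    \<open>t - (t - r)\<close>.\<close>
  have dimN: "sub_dim K VV N = r"
    using V.dim_le_orth_compl[OF fdK sesq \<Gamma>] V.orth_compl_le_dim[OF fdK b \<Gamma>] dimVV rt dim\<Gamma>
    by (simp add: N)
  have hr: "h \<le> r" using evasive_le_dim[OF vsK fdK subV ev UV] dimV by simp
  have U'_img: "U' = (\<lambda>x. N +>\<^bsub>VV\<^esub> x) ` W" by (simp add: U' delsarte_dual_def)
  have U'F: "VectorSpace.subspace ?E U' Q"
    unfolding U'_img Q by (rule F.quotient_image(1)[OF fdF NF W])
  have dim_le_span: "sub_dim ?E VV A \<le> sub_dim K VV (V.span A)"
    if "VectorSpace.subspace ?E A VV" "A \<subseteq> W" for A
    by (rule sub_dim_restrict_scalars_le[OF vsK F fdK fdF W _ spanW that])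
      (simp add: dimVV dimW)

  have part1: "VectorSpace.subspace ?E (X \<inter> U') Q \<and> sub_dim ?E Q (X \<inter> U') \<le> t - k - 2"
    if X: "VectorSpace.subspace K X Q" and dimX: "sub_dim K Q X = t - r + h - k - 1" for X
  proof
    show "VectorSpace.subspace ?E (X \<inter> U') Q"
      by (intro subspace_Int subspace_restrict_scalars[OF X F] U'F)
    \<comment> \<open>The preimage of \<open>X\<close> has dimension \<open>t + h - k - 1\<close>,
      and \<open>X \<inter> U'\<close> is the image of \<open>P \<inter> W\<close>.\<close>
    define P where "P = {x \<in> carrier VV. N +>\<^bsub>VV\<^esub> x \<in> X}"
    note P = V.quotient_vimage[OF fdK NK X[unfolded Q], folded P_def Q]
    have PF: "VectorSpace.subspace ?E (P \<inter> W) VV"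
      by (intro subspace_Int subspace_restrict_scalars[OF P(1) F] W)
    have "X \<inter> U' = (\<lambda>x. N +>\<^bsub>VV\<^esub> x) ` (P \<inter> W)" using WV by (auto simp: U'_img P_def)
    then have "sub_dim ?E Q (X \<inter> U') \<le> sub_dim ?E VV (P \<inter> W)"
      using F.quotient_image(2)[OF fdF NF PF] by (simp add: Q)
    moreover have "sub_dim ?E VV (P \<inter> W) < t - k - 1"
    proof (rule ccontr)
      assume "\<not> ?thesis"
      \<comment> \<open>Dimension \<open>t - k - 1\<close> is one too small for
        \<open>bound\<close>, which would give \<open>t \<le> t - 1\<close>. It is still large
        enough: \<open>N\<close> and the \<open>K\<close>-span of \<open>A\<close> both lie in
        \<open>P\<close>, so they meet in dimension at least
        \<open>r + (t - k - 1) - (t + h - k - 1) = r - h\<close>.\<close>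
      then obtain A where A: "VectorSpace.subspace ?E A VV" "A \<subseteq> P \<inter> W" "sub_dim ?E VV A = t - k - 1"
        using F.subspace_of_dim[OF fdF PF, of "t - k - 1"] by auto
      have AV: "A \<subseteq> carrier VV" using A WV by blast
      have sA: "VectorSpace.subspace K (V.span A) VV" by (rule V.span_is_subspace[OF AV])
      have "sub_dim K VV N + sub_dim K VV (V.span A) \<le> sub_dim K VV P + sub_dim K VV (N \<inter> V.span A)"
        using A(2) by (intro V.sub_dim_add_le fdK NK sA P V.subspace_span_subset) auto
      moreover have "t - k - 1 \<le> sub_dim K VV (V.span A)" using dim_le_span[OF A(1)] A(2,3) by simp
      ultimately have "r \<le> h + sub_dim K VV (N \<inter> V.span A)"
        using dimN P(3) dimX k hr rt by linarith
      then have "t \<le> t - k - 1 + k" using bound[OF A(1)] A(2,3) by simp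
      then show False using k hr rt by linarith
    qed
    ultimately show "sub_dim ?E Q (X \<inter> U') \<le> t - k - 2" by linarith
  qed

  \<comment> \<open>\<open>W \<inter> N\<close> is the kernel of the map from \<open>W\<close> onto
    \<open>U'\<close>. If it had dimension \<open>r - h\<close> or more, an \<open>A\<close> of
    dimension \<open>r - h\<close> inside it would have its whole \<open>K\<close>-span in
    \<open>N\<close>, and \<open>bound\<close> would give \<open>t \<le> r - h + k\<close>.\<close>
  have WN: "sub_dim ?E VV (W \<inter> N) + h < r"
  proof (rule ccontr)
    assume "\<not> ?thesis"
    then have "r - h \<le> sub_dim ?E VV (W \<inter> N)" by simp
    moreover have WNF: "VectorSpace.subspace ?E (W \<inter> N) VV" by (rule subspace_Int[OF W NF])
    ultimately obtain A where A: "VectorSpace.subspace ?E A VV" "A \<subseteq> W \<inter> N" "sub_dim ?E VV A = r - h"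
      using F.subspace_of_dim[OF fdF WNF] by blast
    have "V.span A \<subseteq> N" using V.subspace_span_subset[OF NK] A(2) by blast
    then have "N \<inter> V.span A = V.span A" by blast
    then have "r \<le> h + sub_dim K VV (N \<inter> V.span A)" using dim_le_span[OF A(1)] A(2,3) by simp
    then have "t \<le> r - h + k" using bound[OF A(1)] A(2,3) by simp
    then show False using k hr rt by linarith
  qed
  have dimU': "t - r + h + 1 \<le> sub_dim ?E Q U'"
    using F.quotient_image(2)[OF fdF NF W] WN rt dimW by (simp add: U'_img Q)
  \<comment> \<open>Evasiveness requires positive parameters. \<open>WN\<close> forces
    \<open>h < r\<close>, so \<open>k < t - r + h - 1\<close> yields
    \<open>k < t - 2\<close>.\<close>
  have "0 < t - r + h - k - 1" and "0 < t - k - 2" using k WN rt by linarith+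
  then show ?thesis using part1 U'F dimU' unfolding evasive_def by blast
qed

end
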